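(* Let $\mathcal{U}$, $\mathcal{V}$ and $\mathcal{W}$ be normed vector spaces over $\mathbb{C}$ that are isometrically isomorphic to $\mathbb{C}^l$, $\mathbb{C}^m$ and $\mathbb{C}^n$ respectively, with $m\le n\le l+m$. Assume $\Pi$ is a complex analytic manifold in $\mathcal{U}$ and, for every $\mathbf{u}_0\in\Pi$, there is a holomorphic mapping $(\mathbf{u},\mathbf{v})\mapsto\mathbf{f}(\mathbf{u},\mathbf{v})$ from an open domain $\Omega\subset\mathcal{U}\times\mathcal{V}$ to $\mathcal{W}$ satisfying the following four conditions: (a) There is a $\mathbf{v}_0\in\mathcal{V}$ such that $\mathbf{f}(\mathbf{u}_0,\mathbf{v}_0)=\mathbf{0}$. (b) $\mathbf{f}_{\mathbf{u}\mathbf{v}}(\mathbf{u}_0,\mathbf{v}_0)$ is surjective and $\mathbf{f}_{\mathbf{v}}(\mathbf{u}_0,\mathbf{v}_0)$ is injective. (c) $\mathbf{f}(\mathbf{u},\mathbf{v})=\mathbf{0}$ implies $\mathbf{u}\in\Pi$. (d) For every open neighborhood $\Delta$ of $\mathbf{v}_0$ in $\mathcal{V}$, there is an open neighborhood $\Sigma$ of $\mathbf{u}_0$ in $\mathcal{U}$ such that every $\mathbf{u}\in\Sigma\cap\Pi$ corresponds to a unique $\mathbf{v}\in\Delta$ with $\mathbf{f}(\mathbf{u},\mathbf{v})=\mathbf{0}$. Then, for every $\mathbf{u}_0\in\Pi$ with such $\mathbf{f}$ and $\mathbf{v}_0$, the following assertions hold: (i) There are open neighborhoods $\Psi$ of $\mathbf{u}_0$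 in $\mathcal{U}$ and $\Phi$ of $\mathbf{v}_0$ in $\mathcal{V}$ along with a mapping $\pi:\Psi\to\mathcal{V}$ whose image $\tilde{\mathbf{v}}=\pi(\tilde{\mathbf{u}})\in\Phi$ is the unique least squares solution to the equation $\mathbf{f}(\tilde{\mathbf{u}},\mathbf{v})=\mathbf{0}$ (for the variable $\mathbf{v}$) in $\Phi$ at every $\tilde{\mathbf{u}}\in\Psi$. Furthermore, for every open neighborhood $\check\Phi\subset\Phi$ of $\mathbf{v}_0$ in $\mathcal{V}$, there is an open neighborhood $\check\Psi\subset\Psi$ of $\mathbf{u}_0$ such that $\pi(\check\Psi)\subset\check\Phi$. (ii) The mapping $\pi$ is locally Lipschitz continuous in $\Psi$. (iii) For every $\tilde{\mathbf{u}}\in\Psi$ (serving as empirical data for $\mathbf{u}_0$), the least squares solution $\tilde{\mathbf{v}}=\pi(\tilde{\mathbf{u}})$ satisfies $$\|\tilde{\mathbf{v}}-\mathbf{v}_0\|\le\|\mathbf{f}_{\mathbf{v}}(\mathbf{u}_0,\mathbf{v}_0)^\dagger\|\,\|\mathbf{f}_{\mathbf{u}}(\mathbf{u}_0,\mathbf{v}_0)\|\,\|\tilde{\mathbf{u}}-\mathbf{u}_0\|+o(\|\tilde{\mathbf{u}}-\mathbf{u}_0\|).$$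
   Context: $\mathbb{C}^k$ carries the Euclidean norm; isometrically isomorphic means there is a norm-preserving linear isomorphism. Norms of linear transformations are operator norms. The $o(\cdot)$ term is as $\tilde{\mathbf{u}}\to\mathbf{u}_0$. A mapping from an open subset of a finite-dimensional complex vector space to another is holomorphic if its coordinate representation is holomorphic. A mapping on a non-open set $S$ is holomorphic if it is the restriction to $S$ of a holomorphic mapping defined on an open set containing $S$. Complex analytic manifold: a subset $\Pi$ of a finite-dimensional normed vector space $\mathcal{U}$ over $\mathbb{C}$ is a complex analytic manifold of dimension $d$ if there is a $d$-dimensional normed vector space $\mathcal{X}$ over $\mathbb{C}$ and, for every $\mathbf{u}\in\Pi$, there is an open neighborhood $\Sigma$ of $\mathbf{u}$ in $\mathcal{U}$ and a holomorphic mapping $\phi$ from $\Sigma\cap\Pi$ onto an open subset $\Lambda$ of $\mathcal{X}$ with a holomorphic inverse. For holomorphic $\mathbf{f}$, $\mathbf{f}_{\mathbf{u}\mathbf{v}}(\mathbf{u}_0,\mathbf{v}_0):\mathcal{U}\times\mathcal{V}\to\mathcal{W}$ is its Jacobian (complex derivative, a linear transformation), and $\mathbf{f}_{\mathbf{u}}(\mathbf{u}_0,\mathbf{v}_0):\mathcal{U}\to\mathcal{W}$, $\mathbf{f}_{\mathbf{v}}(\mathbf{u}_0,\mathbf{v}_0):\mathcal{V}\to\mathcal{W}$ are its partial Jacobians. $\mathbf{f}_{\mathbf{v}}(\mathbf{u}_0,\mathbf{v}_0)^\dagger:\mathcal{W}\to\mathcal{V}$ is the Moore-Penrose inverse, defined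 through the isometric isomorphisms of $\mathcal{V},\mathcal{W}$ with $\mathbb{C}^m,\mathbb{C}^n$ from the Moore-Penrose inverse of the representing matrix. Statements such as $\mathbf{f}(\mathbf{u},\mathbf{v})=\mathbf{0}$ are understood to include $(\mathbf{u},\mathbf{v})\in\Omega$. Least squares solution: for a mapping $\mathbf{x}\mapsto\mathbf{g}(\mathbf{x})$ from an open subset $\Theta$ of $\mathcal{V}$ to $\mathcal{W}$, a least squares solution of $\mathbf{g}(\mathbf{x})=\mathbf{0}$ is a point $\mathbf{x}_*\in\Theta$ for which there is an open neighborhood $\Lambda\subset\Theta$ of $\mathbf{x}_*$ with $\|\mathbf{g}(\mathbf{x}_* )\|^2=\min_{\mathbf{x}\in\Lambda}\|\mathbf{g}(\mathbf{x})\|^2$. Here it is applied to $\mathbf{v}\mapsto\mathbf{f}(\tilde{\mathbf{u}},\mathbf{v})$ with $\tilde{\mathbf{u}}$ fixed. *)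

theory Defs
  imports "HOL-Analysis.Analysis" "HOL-Library.Landau_Symbols"
begin

section \<open>Complex normed vector spaces\<close>

class complex_vector = real_vector +
  fixes scaleC :: "complex \<Rightarrow> 'a \<Rightarrow> 'a"  (infixr \<open>*\<^sub>C\<close> 75)
  assumes scaleC_add_right: "a *\<^sub>C (x + y) = a *\<^sub>C x + a *\<^sub>C y"
    and scaleC_add_left: "(a + b) *\<^sub>C x = a *\<^sub>C x + b *\<^sub>C x"
    and scaleC_scaleC: "a *\<^sub>C b *\<^sub>C x = (a * b) *\<^sub>C x"
    and scaleC_one: "1 *\<^sub>C x = x"
    and scaleR_scaleC: "r *\<^sub>R x = complex_of_real r *\<^sub>C x"

class complex_normed_vector = complex_vector + real_normed_vector +
  assumes norm_scaleC: "norm (a *\<^sub>C x) = cmod a * norm x"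

global_interpretation complex_vector: vector_space "scaleC :: complex \<Rightarrow> 'a \<Rightarrow> 'a::complex_vector"
  by unfold_locales (simp_all add: scaleC_add_right scaleC_add_left scaleC_scaleC scaleC_one)

instantiation prod :: (complex_vector, complex_vector) complex_vector
begin

definition scaleC_prod_def: "scaleC a p = (a *\<^sub>C fst p, a *\<^sub>C snd p)"

instance
  by standard (simp_all add: scaleC_prod_def scaleC_add_right scaleC_add_left scaleC_scaleC
      scaleC_one scaleR_prod_def scaleR_scaleC)

end

instance prod :: (complex_normed_vector, complex_normed_vector) complex_normed_vector
proof
  fix a :: complex and p :: "'a \<times> 'b"
  have "norm (a *\<^sub>C p) = sqrt ((cmod a)\<^sup>2 * ((norm (fst p))\<^sup>2 + (norm (snd p))\<^sup>2))"
    by (simp add: scaleC_prod_def norm_prod_def norm_scaleC power_mult_distrib distrib_left)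
  then show "norm (a *\<^sub>C p) = cmod a * norm p"
    by (simp add: real_sqrt_mult norm_prod_def)
qed

definition has_complex_dimension :: "'a::complex_vector itself \<Rightarrow> nat \<Rightarrow> bool" where
  "has_complex_dimension _ d \<longleftrightarrow>
     (\<exists>B :: 'a set. finite B \<and> card B = d \<and> complex_vector.independent B \<and>
        complex_vector.span B = UNIV)"

abbreviation clinear :: "('a::complex_vector \<Rightarrow> 'b::complex_vector) \<Rightarrow> bool" where
  "clinear \<equiv> Vector_Spaces.linear scaleC scaleC"

definition isometric_isomorphism :: "('a::complex_normed_vector \<Rightarrow> complex ^ 'k) \<Rightarrow> bool" where
  "isometric_isomorphism h \<longleftrightarrow>
     Vector_Spaces.linear scaleC (*s) h \<and> bij h \<and> (\<forall>x. norm (h x) = norm x)"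


section \<open>Holomorphic mappings and complex analytic manifolds\<close>

text \<open>
  Complex Frechet differentiability does not depend on coordinates, so it expresses holomorphy of
  the coordinate representation without a choice of bases.
\<close>

definition complex_differentiable ::
    "('a::complex_normed_vector \<Rightarrow> 'b::complex_normed_vector) \<Rightarrow> 'a \<Rightarrow> bool" where
  "complex_differentiable f x \<longleftrightarrow> (\<exists>D. clinear D \<and> (f has_derivative D) (at x))"

text \<open>The set \<open>S\<close> need not be open; see \<open>holomorphic_map_on_open_iff\<close> for the open case.\<close>

definition holomorphic_map_on ::
    "('a::complex_normed_vector \<Rightarrow> 'b::complex_normed_vector) \<Rightarrow> 'a set \<Rightarrow> bool" where
  "holomorphic_map_on f S \<longleftrightarrow>
     (\<exists>T g. open T \<and> S \<subseteq> T \<and> (\<forall>x\<in>T. complex_differentiable g x) \<and> (\<forall>x\<in>S. g x = f x))"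

lemma holomorphic_map_on_open_iff:
  assumes "open S"
  shows "holomorphic_map_on f S \<longleftrightarrow> (\<forall>x\<in>S. complex_differentiable f x)"
proof
  assume "holomorphic_map_on f S"
  then obtain T g where "S \<subseteq> T" and g: "\<forall>x\<in>T. complex_differentiable g x" "\<forall>x\<in>S. g x = f x"
    unfolding holomorphic_map_on_def by blast
  show "\<forall>x\<in>S. complex_differentiable f x"
  proof
    fix x assume "x \<in> S"
    with \<open>S \<subseteq> T\<close> g(1) obtain D where "clinear D" "(g has_derivative D) (at x)"
      unfolding complex_differentiable_def by blast
    moreover have "(f has_derivative D) (at x)"
      by (rule has_derivative_transform_within_open[OF calculation(2) assms \<open>x \<in> S\<close>])
        (use g(2) in simp)
    ultimately show "complex_differentiable f x"
      unfolding complex_differentiable_def by blast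
  qed
next
  assume "\<forall>x\<in>S. complex_differentiable f x"
  with assms show "holomorphic_map_on f S"
    unfolding holomorphic_map_on_def by blast
qed

text \<open>
  The model space is the type \<open>'x\<close>. The dimension \<open>d\<close> may be \<open>0\<close>, and \<open>M\<close> carries the
  structure of a submanifold, since \<open>\<phi>\<close> is the restriction of a mapping of the ambient space.
\<close>

definition complex_analytic_manifold ::
    "'x::complex_normed_vector itself \<Rightarrow> nat \<Rightarrow> 'u::complex_normed_vector set \<Rightarrow> bool" where
  "complex_analytic_manifold X d M \<longleftrightarrow>
     has_complex_dimension X d \<and>
     (\<forall>u\<in>M. \<exists>\<Sigma> \<Lambda> (\<phi> :: 'u \<Rightarrow> 'x) \<psi>.
        open \<Sigma> \<and> u \<in> \<Sigma> \<and> open \<Lambda> \<and>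
        holomorphic_map_on \<phi> (\<Sigma> \<inter> M) \<and> \<phi> ` (\<Sigma> \<inter> M) = \<Lambda> \<and>
        holomorphic_map_on \<psi> \<Lambda> \<and> (\<forall>y\<in>\<Sigma> \<inter> M. \<psi> (\<phi> y) = y))"


section \<open>Moore-Penrose inverses\<close>

definition conj_transpose :: "complex ^ 'm ^ 'n \<Rightarrow> complex ^ 'n ^ 'm" where
  "conj_transpose A = (\<chi> i j. cnj (A $ j $ i))"

definition matrix_moore_penrose :: "complex ^ 'm ^ 'n \<Rightarrow> complex ^ 'n ^ 'm" where
  "matrix_moore_penrose A =
     (THE X. A ** X ** A = A \<and> X ** A ** X = X \<and>
        conj_transpose (A ** X) = A ** X \<and> conj_transpose (X ** A) = X ** A)"

text \<open>
  \<open>h\<close> and \<open>k\<close> are isometric isomorphisms of the domain and the codomain of \<open>L\<close> with coordinate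
  spaces.
\<close>

definition moore_penrose ::
    "('v \<Rightarrow> complex ^ 'm) \<Rightarrow> ('w \<Rightarrow> complex ^ 'n) \<Rightarrow> ('v \<Rightarrow> 'w) \<Rightarrow> 'w \<Rightarrow> 'v" where
  "moore_penrose h k L =
     (\<lambda>w. inv h (matrix_moore_penrose (matrix (k \<circ> L \<circ> inv h)) *v k w))"


section \<open>Least squares solutions\<close>

definition least_squares_solution ::
    "'v::real_normed_vector set \<Rightarrow> ('v \<Rightarrow> 'w::real_normed_vector) \<Rightarrow> 'v \<Rightarrow> bool" where
  "least_squares_solution \<Theta> g x \<longleftrightarrow>
     x \<in> \<Theta> \<and>
     (\<exists>\<Lambda>. open \<Lambda> \<and> x \<in> \<Lambda> \<and> \<Lambda> \<subseteq> \<Theta> \<and> (\<forall>y\<in>\<Lambda>. (norm (g x))\<^sup>2 \<le> (norm (g y))\<^sup>2))"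


section \<open>Partial Jacobians and the equations defining the manifold\<close>

text \<open>
  At a point of complex differentiability the (real) Frechet derivative is the complex linear
  Jacobian.
\<close>

definition jacobian_u ::
    "('u::real_normed_vector \<times> 'v::real_normed_vector \<Rightarrow> 'w::real_normed_vector) \<Rightarrow>
      'u \<Rightarrow> 'v \<Rightarrow> 'u \<Rightarrow> 'w" where
  "jacobian_u f u0 v0 = frechet_derivative (\<lambda>u. f (u, v0)) (at u0)"

definition jacobian_v ::
    "('u::real_normed_vector \<times> 'v::real_normed_vector \<Rightarrow> 'w::real_normed_vector) \<Rightarrow>
      'u \<Rightarrow> 'v \<Rightarrow> 'v \<Rightarrow> 'w" where
  "jacobian_v f u0 v0 = frechet_derivative (\<lambda>v. f (u0, v)) (at v0)"

definition defining_system ::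
    "'u::complex_normed_vector set \<Rightarrow> ('u \<times> 'v::complex_normed_vector) set \<Rightarrow>
      ('u \<times> 'v \<Rightarrow> 'w::complex_normed_vector) \<Rightarrow> 'u \<Rightarrow> 'v \<Rightarrow> bool" where
  "defining_system M Om f u0 v0 \<longleftrightarrow>
     open Om \<and> holomorphic_map_on f Om \<and>
     (u0, v0) \<in> Om \<and> f (u0, v0) = 0 \<and>
     surj (frechet_derivative f (at (u0, v0))) \<and> inj (jacobian_v f u0 v0) \<and>
     (\<forall>u v. (u, v) \<in> Om \<and> f (u, v) = 0 \<longrightarrow> u \<in> M) \<and>
     (\<forall>\<Delta>. open \<Delta> \<and> v0 \<in> \<Delta> \<longrightarrow>
        (\<exists>\<Sigma>. open \<Sigma> \<and> u0 \<in> \<Sigma> \<and>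
           (\<forall>u\<in>\<Sigma> \<inter> M. \<exists>!v. v \<in> \<Delta> \<and> (u, v) \<in> Om \<and> f (u, v) = 0)))"

end

theory Submission
  imports Defs "HOL-Complex_Analysis.Cauchy_Integral_Formula"
begin

text \<open>
  Composing \<open>f\<close> with the isometry \<open>hW\<close> changes no residual norm and turns the residual into a mapping
  \<open>g\<close> with values in the real inner product space \<open>complex ^ 'n\<close>. A least squares solution
  \<open>v\<close> at \<open>u\<close> is then a critical point of \<open>v \<mapsto> norm (g (u, v))\<^sup>2\<close>: the residual \<open>g (u, v)\<close> is
  orthogonal to every \<open>D (u, v) (0, k)\<close>, where \<open>D\<close> is the derivative of \<open>g\<close>. Everything happens
  near the zero \<open>(u0, v0)\<close>, where the residual is small and \<open>k \<mapsto> D (u, v) (0, k)\<close> is uniformly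
  injective.
  
  For two critical points, subtract the two orthogonality relations, tested with the direction
  \<open>h = v1 - v2\<close>. What remains is \<open>(norm (D (0, h)))\<^sup>2\<close>, a term of size
  \<open>norm (u1 - u2) * norm h\<close>, and errors that carry a small residual or a small distance as a factor.
  The errors are controlled because the derivative of a holomorphic mapping is locally Lipschitz, by
  Cauchy estimates (\<open>holomorphic_derivative_locally_lipschitz\<close>). Uniform injectivity absorbs them,
  which leaves \<open>norm (v1 - v2) \<le> L * norm (u1 - u2)\<close> (\<open>critical_lipschitz\<close>). This single
  inequality gives uniqueness (take \<open>u1 = u2\<close>), the Lipschitz property, and convergence to \<open>v0\<close>.
  
  Existence is compactness: a minimizer over a closed ball around \<open>v0\<close> is no worse than \<open>v0\<close>, so
  injectivity in the \<open>v\<close> direction forces it into the interior when \<open>u\<close> is close to \<open>u0\<close>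
  (\<open>residual_minimum_exists\<close>).
  
  For the error bound, let \<open>B\<close> and \<open>A\<close> be the partial Jacobians at the zero. By the Lipschitz
  property, the orthogonality relation at \<open>(u, \<pi> u)\<close> becomes the normal equation for
  \<open>B (u - u0) + A (\<pi> u - v0)\<close> up to an error of order \<open>(norm (u - u0))\<^sup>2\<close>
  (\<open>critical_normal_equation\<close>). The Moore-Penrose inverse solves exact normal equations, so
  \<open>\<pi> u - v0\<close> differs from minus the Moore-Penrose inverse applied to \<open>B (u - u0)\<close> by a term of
  the same order (\<open>least_squares_residual_bound\<close>).
\<close>

section \<open>Isometric coordinates\<close>

lemma isometric_isomorphismD:
  assumes "isometric_isomorphism h"
  shows "h (x + y) = h x + h y"
    and "h (c *\<^sub>C x) = c *s h x"
    and "norm (h x) = norm x"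
    and "bij h"
proof -
  interpret Vector_Spaces.linear scaleC "(*s)" h
    using assms by (simp add: isometric_isomorphism_def)
  show "h (x + y) = h x + h y" "h (c *\<^sub>C x) = c *s h x"
    by (rule add scale)+
qed (use assms in \<open>auto simp: isometric_isomorphism_def\<close>)

lemma isometric_isomorphism_bounded_linear:
  assumes "isometric_isomorphism h"
  shows "bounded_linear h"
proof (rule bounded_linear_intro[where K = 1])
  show "h (r *\<^sub>R x) = r *\<^sub>R h x" for r x
    using isometric_isomorphismD(2)[OF assms, of "complex_of_real r" x]
    by (simp add: scaleR_scaleC vec_eq_iff scaleR_conv_of_real[where 'a = complex])
qed (simp_all add: isometric_isomorphismD[OF assms])

lemma isometric_isomorphism_inv:
  assumes "isometric_isomorphism h"
  shows "inv h (h x) = x" and "h (inv h y) = y" and "norm (inv h y) = norm y"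
    and "bounded_linear (inv h)"
proof -
  have bij: "bij h"
    by (rule isometric_isomorphismD(4)[OF assms])
  show *: "inv h (h x) = x" "h (inv h y) = y" for x y
    using bij by (simp_all add: bij_is_inj bij_is_surj surj_f_inv_f)
  show norm_inv: "norm (inv h y) = norm y" for y
    using isometric_isomorphismD(3)[OF assms, of "inv h y"] * by simp
  interpret h: bounded_linear h
    by (rule isometric_isomorphism_bounded_linear[OF assms])
  show "bounded_linear (inv h)"
  proof (rule bounded_linear_intro[where K = 1])
    show "inv h (x + y) = inv h x + inv h y" for x y
      by (metis * h.add)
    show "inv h (r *\<^sub>R x) = r *\<^sub>R inv h x" for r x
      by (metis * h.scaleR)
  qed (simp add: norm_inv)
qed

lemma isometric_isomorphism_compact_cball:
  fixes h :: "'v::complex_normed_vector \<Rightarrow> complex ^ 'm" and x :: 'v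
  assumes "isometric_isomorphism h"
  shows "compact (cball x \<rho>)"
proof -
  interpret h: bounded_linear h
    by (rule isometric_isomorphism_bounded_linear[OF assms])
  have "cball x \<rho> = inv h ` cball (h x) \<rho>"
  proof (intro set_eqI iffI)
    fix y assume "y \<in> cball x \<rho>"
    then have "h y \<in> cball (h x) \<rho>"
      by (simp add: dist_norm isometric_isomorphismD(3)[OF assms] flip: h.diff)
    then show "y \<in> inv h ` cball (h x) \<rho>"
      using isometric_isomorphism_inv(1)[OF assms, of y] by (metis imageI)
  next
    fix y assume "y \<in> inv h ` cball (h x) \<rho>"
    then have "h y \<in> cball (h x) \<rho>"
      by (auto simp: isometric_isomorphism_inv(2)[OF assms])
    then show "y \<in> cball x \<rho>"
      by (simp add: dist_norm isometric_isomorphismD(3)[OF assms] flip: h.diff)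
  qed
  moreover have "compact (inv h ` cball (h x) \<rho>)"
    by (intro compact_continuous_image compact_cball
        linear_continuous_on isometric_isomorphism_inv(4)[OF assms])
  ultimately show ?thesis
    by simp
qed


section \<open>Moore-Penrose inverses of injective matrices\<close>

lemma conj_transpose_mult: "conj_transpose (A ** B) = conj_transpose B ** conj_transpose A"
  by (simp add: conj_transpose_def matrix_matrix_mult_def vec_eq_iff mult.commute)

lemma conj_transpose_conj_transpose [simp]: "conj_transpose (conj_transpose A) = A"
  by (simp add: conj_transpose_def vec_eq_iff)

lemma conj_transpose_mat_1 [simp]: "conj_transpose (mat 1) = mat 1"
  by (simp add: conj_transpose_def mat_def vec_eq_iff)

text \<open>
  The real inner product of \<open>complex ^ 'n\<close> is the real part of the Hermitian one. Therefore the
  Hermitian adjoint is also the adjoint for the real inner product, and the whole argument can use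
  the real one.
\<close>

lemma inner_conj_transpose:
  fixes A :: "complex ^ 'm ^ 'n"
  shows "inner (A *v x) y = inner x (conj_transpose A *v y)"
proof -
  have Re_inner: "inner a b = Re (\<Sum>i\<in>UNIV. a $ i * cnj (b $ i))" for a b :: "complex ^ 'k"
    by (simp add: inner_vec_def inner_complex_def Re_sum)
  have "(\<Sum>i\<in>UNIV. (A *v x) $ i * cnj (y $ i)) =
        (\<Sum>i\<in>UNIV. \<Sum>j\<in>UNIV. A $ i $ j * x $ j * cnj (y $ i))"
    by (simp add: matrix_vector_mult_def sum_distrib_right)
  also have "\<dots> = (\<Sum>j\<in>UNIV. \<Sum>i\<in>UNIV. A $ i $ j * x $ j * cnj (y $ i))"
    by (rule sum.swap)
  also have "\<dots> = (\<Sum>j\<in>UNIV. x $ j * cnj ((conj_transpose A *v y) $ j))"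
    by (simp add: matrix_vector_mult_def conj_transpose_def sum_distrib_left ac_simps)
  finally show ?thesis
    by (simp add: Re_inner)
qed

text \<open>
  For injective \<open>A\<close> the Gram matrix \<open>A\<^sup>* A\<close> is invertible and \<open>inverse (A\<^sup>* A) A\<^sup>*\<close> satisfies the four
  Penrose equations; as usual, Hermitian symmetry of \<open>A X\<close> and \<open>A Y\<close> forces two solutions to agree.
  The two conclusions say that \<open>A X\<close> is the orthogonal projection onto the range of \<open>A\<close>.
\<close>

lemma matrix_moore_penrose_injective:
  fixes A :: "complex ^ 'm ^ 'n"
  assumes "inj ((*v) A)"
  shows "matrix_moore_penrose A ** A = mat 1"
    and "conj_transpose (A ** matrix_moore_penrose A) = A ** matrix_moore_penrose A"
proof -
  let ?H = "conj_transpose A ** A"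
  let ?MP = "\<lambda>X. A ** X ** A = A \<and> X ** A ** X = X \<and>
        conj_transpose (A ** X) = A ** X \<and> conj_transpose (X ** A) = X ** A"
  obtain L where L: "L ** A = mat 1"
    using assms matrix_left_invertible_injective by blast
  have cancel: "X ** A = mat 1" if "?MP X" for X
  proof -
    have "X ** A = L ** (A ** X ** A)"
      by (simp add: matrix_mul_assoc L)
    then show ?thesis
      using that L by simp
  qed
  have "inj ((*v) ?H)"
  proof (rule injI)
    fix x y assume "?H *v x = ?H *v y"
    then have "?H *v (x - y) = 0"
      by (simp add: matrix_vector_mult_diff_distrib)
    then have "inner (A *v (x - y)) (A *v (x - y)) = 0"
      by (simp add: inner_conj_transpose matrix_vector_mul_assoc)
    then have "A *v x = A *v y"
      by (simp add: matrix_vector_mult_diff_distrib)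
    then show "x = y"
      using assms by (simp add: inj_eq)
  qed
  then obtain G where G: "G ** ?H = mat 1" "?H ** G = mat 1"
    using matrix_left_invertible_injective matrix_left_right_inverse by blast
  have "conj_transpose G = conj_transpose G ** (?H ** G)"
    using G by simp
  also have "\<dots> = conj_transpose (?H ** G) ** G"
    by (simp add: conj_transpose_mult matrix_mul_assoc)
  also have "\<dots> = G"
    using G by simp
  finally have G_herm: "conj_transpose G = G" .
  have ex: "?MP (G ** conj_transpose A)"
  proof -
    have XA: "G ** conj_transpose A ** A = mat 1"
      using G by (simp flip: matrix_mul_assoc)
    have "A ** G ** conj_transpose A ** A = A"
      by (metis XA matrix_mul_assoc matrix_mul_rid)
    with XA show ?thesis
      by (simp add: conj_transpose_mult G_herm matrix_mul_assoc)
  qed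
  have uniq: "X = Y" if X: "?MP X" and Y: "?MP Y" for X Y
  proof -
    have "A ** X = A ** Y ** (A ** X)"
      using Y by (simp add: matrix_mul_assoc)
    also have "\<dots> = conj_transpose (A ** X ** (A ** Y))"
      using X Y by (simp add: conj_transpose_mult)
    also have "\<dots> = conj_transpose (A ** Y)"
      using X by (simp add: matrix_mul_assoc)
    also have "\<dots> = A ** Y"
      using Y by simp
    finally have "X ** (A ** X) = X ** (A ** Y)"
      by simp
    then show ?thesis
      using cancel[OF X] X by (simp add: matrix_mul_assoc)
  qed
  have "?MP (matrix_moore_penrose A)"
    unfolding matrix_moore_penrose_def by (rule theI[of ?MP, OF ex]) (rule uniq[OF _ ex])
  then show "matrix_moore_penrose A ** A = mat 1"
    and "conj_transpose (A ** matrix_moore_penrose A) = A ** matrix_moore_penrose A"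
    using cancel by auto
qed

lemma moore_penrose_injective:
  fixes L :: "'v::complex_normed_vector \<Rightarrow> 'w::complex_normed_vector"
  assumes h: "isometric_isomorphism (h :: 'v \<Rightarrow> complex ^ 'm)"
    and k: "isometric_isomorphism (k :: 'w \<Rightarrow> complex ^ 'n)"
    and L: "clinear L" "inj L"
  shows "bounded_linear (moore_penrose h k L)"
    and "moore_penrose h k L (L x) = x"
    and "inner (k w - k (L (moore_penrose h k L w))) (k (L x)) = 0"
proof -
  interpret L: Vector_Spaces.linear scaleC scaleC L
    by (rule L)
  define A where "A = matrix (k \<circ> L \<circ> inv h)"
  define X where "X = matrix_moore_penrose A"
  have mp: "moore_penrose h k L w = inv h (X *v k w)" for w
    by (simp add: moore_penrose_def A_def X_def)
  note hD = isometric_isomorphismD[OF h] isometric_isomorphism_inv[OF h]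
  note kD = isometric_isomorphismD[OF k] isometric_isomorphism_inv[OF k]
  have add: "inv h (x + y) = inv h x + inv h y" for x y
    by (metis hD)
  have scale: "inv h (c *s x) = c *\<^sub>C inv h x" for c x
    by (metis hD)
  have "Vector_Spaces.linear (*s) (*s) (k \<circ> L \<circ> inv h)"
    by unfold_locales (simp_all add: add scale L.add L.scale kD)
  then have A: "A *v y = k (L (inv h y))" for y
    unfolding A_def by (simp add: matrix_works)
  have "inj ((*v) A)"
    by (rule injI) (metis A hD(6) kD(5) L(2) injD)
  note X = matrix_moore_penrose_injective[OF this, folded X_def]
  show "bounded_linear (moore_penrose h k L)"
    unfolding mp
    by (intro bounded_linear_compose[OF hD(8)] bounded_linear_compose[OF matrix_vector_mul_bounded_linear]
        isometric_isomorphism_bounded_linear k)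
  have XL: "X *v k (L x) = h x" for x
    using X(1) A[of "h x"] by (metis hD(5) matrix_vector_mul_assoc matrix_vector_mul_lid)
  then show "moore_penrose h k L (L x) = x"
    by (simp add: mp hD)
  have "inner (A *v (X *v k w)) (k (L x)) = inner (k w) ((A ** X) *v k (L x))"
    using inner_conj_transpose[of "A ** X"] X(2) by (simp add: matrix_vector_mul_assoc)
  also have "\<dots> = inner (k w) (k (L x))"
    using XL A[of "h x"] by (simp add: hD flip: matrix_vector_mul_assoc)
  finally show "inner (k w - k (L (moore_penrose h k L w))) (k (L x)) = 0"
    by (simp add: mp A inner_diff_left)
qed

section \<open>Derivatives of holomorphic mappings\<close>

text \<open>
  Along the complex line through \<open>z0\<close> with direction \<open>x\<close>, \<open>p\<close> is a holomorphic function of one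
  variable with derivative \<open>P z0 x\<close> at \<open>0\<close>, so the classical Cauchy inequality applies. The factor
  \<open>2\<close> comes from a circle whose image lies at distance \<open>r / 2\<close> from \<open>z0\<close>, inside the open ball.
\<close>

lemma cauchy_estimate_scalar:
  fixes p :: "'a::complex_normed_vector \<Rightarrow> complex" and B :: real
  assumes deriv: "\<And>z. z \<in> ball z0 r \<Longrightarrow> (p has_derivative P z) (at z)"
    and homogeneous: "\<And>z c x. z \<in> ball z0 r \<Longrightarrow> P z (c *\<^sub>C x) = c * P z x"
    and bound: "\<And>z. z \<in> ball z0 r \<Longrightarrow> cmod (p z) \<le> B"
    and r: "0 < r"
  shows "cmod (P z0 x) \<le> 2 * B / r * norm x"
proof (cases "x = 0")
  case True
  interpret bounded_linear "P z0"
    using deriv[of z0] r by (auto intro: has_derivative_bounded_linear)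
  show ?thesis
    using True by (simp add: zero)
next
  case False
  define q where "q t = p (z0 + t *\<^sub>C x)" for t
  define \<delta> where "\<delta> = r / (2 * norm x)"
  have \<delta>: "0 < \<delta>"
    using False r by (simp add: \<delta>_def)
  have in_ball: "z0 + t *\<^sub>C x \<in> ball z0 r" if "t \<in> cball 0 \<delta>" for t
  proof -
    have "norm (t *\<^sub>C x) \<le> \<delta> * norm x"
      using that by (simp add: norm_scaleC mult_right_mono)
    also have "\<dots> < r"
      using False r by (simp add: \<delta>_def)
    finally show ?thesis
      by (simp add: dist_norm)
  qed
  have line: "bounded_linear (\<lambda>t. t *\<^sub>C x)"
    by (rule bounded_linear_intro[where K = "norm x"])
      (simp_all add: scaleC_add_left norm_scaleC scaleR_scaleC scaleC_scaleC scaleR_conv_of_real)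
  have q': "(q has_field_derivative P (z0 + t *\<^sub>C x) x) (at t)" if "t \<in> cball 0 \<delta>" for t
  proof -
    have "((\<lambda>t. z0 + t *\<^sub>C x) has_derivative (\<lambda>t. t *\<^sub>C x)) (at t)"
      by (auto intro!: derivative_eq_intros bounded_linear.has_derivative[OF line])
    from has_derivative_compose[OF this deriv[OF in_ball[OF that]]]
    have "(q has_derivative (\<lambda>s. P (z0 + t *\<^sub>C x) (s *\<^sub>C x))) (at t)"
      by (simp add: q_def[abs_def])
    then show ?thesis
      by (simp add: has_field_derivative_def homogeneous[OF in_ball[OF that]] mult.commute
          mult_commute_abs)
  qed
  have "norm ((deriv ^^ 1) q 0) \<le> fact 1 * B / \<delta> ^ 1"
  proof (rule Cauchy_inequality)
    show "q holomorphic_on ball 0 \<delta>"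
      using q' by (intro holomorphic_onI) (meson ball_subset_cball field_differentiable_at_within
          field_differentiable_def subsetD)
    show "continuous_on (cball 0 \<delta>) q"
      using q' by (meson DERIV_isCont continuous_at_imp_continuous_on)
    show "norm (q t) \<le> B" if "norm (0 - t) = \<delta>" for t
      unfolding q_def using that by (intro bound in_ball) simp
  qed (rule \<delta>)
  moreover have "deriv q 0 = P z0 x"
    using q'[of 0] \<delta> by (auto intro!: DERIV_imp_deriv)
  ultimately have "norm (P z0 x) \<le> B / \<delta>"
    by simp
  then show ?thesis
    by (simp add: \<delta>_def ac_simps)
qed

lemma cauchy_estimate:
  fixes F :: "'a::complex_normed_vector \<Rightarrow> complex ^ 'n" and B :: real
  assumes deriv: "\<And>z. z \<in> ball z0 r \<Longrightarrow> (F has_derivative D z) (at z)"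
    and homogeneous: "\<And>z c x. z \<in> ball z0 r \<Longrightarrow> D z (c *\<^sub>C x) = c *s D z x"
    and bound: "\<And>z. z \<in> ball z0 r \<Longrightarrow> norm (F z) \<le> B"
    and r: "0 < r"
  shows "norm (D z0 x) \<le> 2 * real CARD('n) * B / r * norm x"
proof -
  have "cmod (D z0 x $ i) \<le> 2 * B / r * norm x" for i
  proof (rule cauchy_estimate_scalar[where p = "\<lambda>z. F z $ i" and P = "\<lambda>z x. D z x $ i"])
    show "((\<lambda>z. F z $ i) has_derivative (\<lambda>x. D z x $ i)) (at z)" if "z \<in> ball z0 r" for z
      by (rule bounded_linear.has_derivative[OF bounded_linear_vec_nth deriv[OF that]])
    show "cmod (F z $ i) \<le> B" if "z \<in> ball z0 r" for z
      using bound[OF that] Finite_Cartesian_Product.norm_nth_le[of "F z" i] by simp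
  qed (simp_all add: homogeneous r)
  then have "(\<Sum>i\<in>UNIV. cmod (D z0 x $ i)) \<le> of_nat CARD('n) * (2 * B / r * norm x)"
    by (intro sum_bounded_above)
  moreover have "norm (D z0 x) \<le> (\<Sum>i\<in>UNIV. cmod (D z0 x $ i))"
    unfolding norm_vec_def by (rule L2_set_le_sum) simp
  ultimately show ?thesis
    by (simp add: algebra_simps)
qed

text \<open>
  A Cauchy estimate from a local bound on \<open>F\<close> bounds \<open>D\<close>, which makes \<open>F\<close> Lipschitz. The translates
  of \<open>F\<close> by \<open>z\<close> and \<open>z'\<close> then differ by at most a multiple of \<open>norm (z - z')\<close>, and a second
  Cauchy estimate, for the difference of the translates, bounds \<open>D z - D z'\<close>. No second derivative
  has to be constructed.
\<close>

lemma holomorphic_derivative_locally_lipschitz: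
  fixes F :: "'a::complex_normed_vector \<Rightarrow> complex ^ 'n"
  assumes "open S" and "z0 \<in> S"
    and deriv: "\<And>z. z \<in> S \<Longrightarrow> (F has_derivative D z) (at z)"
    and homogeneous: "\<And>z c x. z \<in> S \<Longrightarrow> D z (c *\<^sub>C x) = c *s D z x"
  obtains r C K where "0 < r" and "ball z0 r \<subseteq> S" and "0 \<le> C" and "0 \<le> K"
    and "\<And>z x. z \<in> ball z0 r \<Longrightarrow> norm (D z x) \<le> C * norm x"
    and "\<And>z z' x. z \<in> ball z0 r \<Longrightarrow> z' \<in> ball z0 r \<Longrightarrow>
           norm (D z x - D z' x) \<le> K * norm (z - z') * norm x"
proof -
  let ?n = "2 * real CARD('n)"
  have "isCont F z0"
    using deriv[OF \<open>z0 \<in> S\<close>] by (rule has_derivative_continuous)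
  then obtain \<delta> where \<delta>: "0 < \<delta>" "\<And>z. dist z z0 < \<delta> \<Longrightarrow> dist (F z) (F z0) < 1"
    unfolding continuous_at_eps_delta by (metis dist_commute zero_less_one)
  obtain e where e: "0 < e" "ball z0 e \<subseteq> S"
    using \<open>open S\<close> \<open>z0 \<in> S\<close> open_contains_ball by blast
  define r where "r = min \<delta> e / 3"
  define B where "B = norm (F z0) + 1"
  have r: "0 < r" and rS: "ball z0 (3 * r) \<subseteq> S" and "0 \<le> B"
    using \<delta>(1) e by (auto simp: r_def B_def)
  have FB: "norm (F z) \<le> B" if "z \<in> ball z0 (3 * r)" for z
  proof -
    have "dist (F z) (F z0) < 1"
      using that by (intro \<delta>(2)) (auto simp: r_def dist_commute)
    then show ?thesis
      using norm_triangle_ineq2[of "F z" "F z0"] by (simp add: B_def dist_norm)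
  qed
  have ball_add: "z + y \<in> ball z0 (t + r)" if "z \<in> ball z0 t" "norm y < r" for z y t
    using that norm_triangle_ineq[of "z - z0" y]
    by (simp add: dist_norm norm_minus_commute[of z0] algebra_simps)
  define C where "C = ?n * B / r"
  have C: "0 \<le> C"
    using r \<open>0 \<le> B\<close> by (simp add: C_def)
  have DC: "norm (D z x) \<le> C * norm x" if z: "z \<in> ball z0 (2 * r)" for z x
  proof -
    have sub: "w \<in> ball z0 (3 * r)" if "w \<in> ball z r" for w
      using ball_add[OF z, of "w - z"] that by (simp add: dist_norm norm_minus_commute)
    show ?thesis
      unfolding C_def
      by (rule cauchy_estimate[where F = F and D = D])
        (use sub rS r in \<open>auto intro!: deriv homogeneous FB\<close>)
  qed
  have F_lip: "norm (F z - F z') \<le> C * norm (z - z')"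
    if "z \<in> ball z0 (2 * r)" "z' \<in> ball z0 (2 * r)" for z z'
  proof (rule differentiable_bound[where f' = D])
    fix x assume x: "x \<in> ball z0 (2 * r)"
    then show "(F has_derivative D x) (at x within ball z0 (2 * r))"
      using r rS by (intro has_derivative_at_withinI[OF deriv]) auto
    show "onorm (D x) \<le> C"
      by (rule onorm_bound[OF C DC[OF x]])
  qed (use that in auto)
  define K where "K = ?n * C / r"
  show thesis
  proof (rule that[of r C K])
    show "ball z0 r \<subseteq> S"
      using r rS by (auto simp: subset_eq)
    show "norm (D z x) \<le> C * norm x" if "z \<in> ball z0 r" for z x
      using that r by (intro DC) auto
    show "norm (D z x - D z' x) \<le> K * norm (z - z') * norm x"
      if z: "z \<in> ball z0 r" "z' \<in> ball z0 r" for z z' x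
    proof -
      have in2: "z + y \<in> ball z0 (2 * r)" "z' + y \<in> ball z0 (2 * r)" if "y \<in> ball 0 r" for y
        using ball_add[OF z(1), of y] ball_add[OF z(2), of y] that by simp_all
      then have inS: "z + y \<in> S" "z' + y \<in> S" if "y \<in> ball 0 r" for y
        using that r rS by (force simp: subset_eq)+
      \<comment> \<open>the second Cauchy estimate, for the difference of two translates of \<open>F\<close>\<close>
      have "norm (D (z + 0) x - D (z' + 0) x) \<le> ?n * (C * norm (z - z')) / r * norm x"
      proof (rule cauchy_estimate[where F = "\<lambda>y. F (z + y) - F (z' + y)"
              and D = "\<lambda>y x. D (z + y) x - D (z' + y) x"])
        fix y :: 'a assume y: "y \<in> ball 0 r"
        have shift: "((\<lambda>y. F (a + y)) has_derivative D (a + y)) (at y)" if "a + y \<in> S" for a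
          by (rule has_derivative_compose[where f = "\<lambda>y. a + y", OF _ deriv[OF that]])
            (auto intro!: derivative_eq_intros)
        show "((\<lambda>y. F (z + y) - F (z' + y)) has_derivative (\<lambda>x. D (z + y) x - D (z' + y) x)) (at y)"
          by (intro has_derivative_diff shift inS y)
        show "D (z + y) (c *\<^sub>C x) - D (z' + y) (c *\<^sub>C x) = c *s (D (z + y) x - D (z' + y) x)"
          for c x
          by (simp add: homogeneous inS[OF y] vec.scale_right_diff_distrib)
        show "norm (F (z + y) - F (z' + y)) \<le> C * norm (z - z')"
          using F_lip[OF in2[OF y]] by simp
      qed (rule r)
      then show ?thesis
        by (simp add: K_def algebra_simps)
    qed
  qed (use r C in \<open>simp_all add: K_def\<close>)
qed

section \<open>Stability of critical points of the squared residual\<close>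

lemma least_squares_solution_critical:
  fixes G :: "'b::real_normed_vector \<Rightarrow> 'c::real_inner"
  assumes "least_squares_solution \<Theta> G x" and G': "(G has_derivative G') (at x)"
  shows "inner (G x) (G' k) = 0"
proof -
  obtain \<Lambda> where \<Lambda>: "open \<Lambda>" "x \<in> \<Lambda>" "\<forall>y\<in>\<Lambda>. (norm (G x))\<^sup>2 \<le> (norm (G y))\<^sup>2"
    using assms(1) unfolding least_squares_solution_def by blast
  have "((\<lambda>y. inner (G y) (G y)) has_derivative (\<lambda>k. inner (G x) (G' k) + inner (G' k) (G x))) (at x)"
    by (rule has_derivative_inner[OF G' G'])
  moreover have "(\<forall>y\<in>\<Lambda>. inner (G y) (G y) \<le> inner (G x) (G x)) \<or>
      (\<forall>y\<in>\<Lambda>. inner (G x) (G x) \<le> inner (G y) (G y))"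
    using \<Lambda>(3) by (simp add: dot_square_norm)
  ultimately have "(\<lambda>k. inner (G x) (G' k) + inner (G' k) (G x)) = (\<lambda>k. 0)"
    by (rule differential_zero_maxmin[OF \<Lambda>(2,1)])
  then have "inner (G x) (G' k) + inner (G' k) (G x) = 0"
    by (rule fun_cong)
  then show ?thesis
    by (simp add: inner_commute)
qed

text \<open>
  The hypotheses on \<open>X\<close> make \<open>A (X w)\<close> the orthogonal projection of \<open>w\<close> onto the range of \<open>A\<close>. For
  \<open>w = b + A h\<close>, \<open>X w = X b + h\<close>, and this is small because its image under \<open>A\<close> is the part of \<open>w\<close>
  inside the range, to which \<open>w\<close> is nearly orthogonal. So \<open>h\<close> is close to \<open>- X b\<close>.
\<close>

lemma least_squares_residual_bound:
  fixes A :: "'b::real_normed_vector \<Rightarrow> 'c::real_inner" and X :: "'c \<Rightarrow> 'b"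
  assumes "linear X" and left_inverse: "X (A h) = h"
    and orthogonal: "\<And>w k. inner (w - A (X w)) (A k) = 0"
    and below: "\<And>k. c * norm k \<le> norm (A k)" "0 < c"
    and residual: "\<And>k. inner (b + A h) (A k) \<le> q * norm k" and "0 \<le> q"
  shows "norm h \<le> norm (X b) + q / c\<^sup>2"
proof -
  define e where "e = X (b + A h)"
  have e: "e = X b + h"
    using linear_add[OF \<open>linear X\<close>] by (simp add: e_def left_inverse)
  have "(c * norm e)\<^sup>2 \<le> (norm (A e))\<^sup>2"
    using below by (intro power_mono) auto
  also have "\<dots> = inner (A e) (A e)"
    by (simp add: dot_square_norm)
  also have "\<dots> = inner (b + A h) (A e)"
    using orthogonal[of "b + A h" e] by (simp add: e_def inner_diff_left)
  also have "\<dots> \<le> q * norm e"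
    by (rule residual)
  finally have *: "c\<^sup>2 * norm e * norm e \<le> q * norm e"
    by (simp add: power2_eq_square algebra_simps)
  have "norm e \<le> q / c\<^sup>2"
  proof (cases "e = 0")
    case True
    then show ?thesis
      using \<open>0 \<le> q\<close> by simp
  next
    case False
    then show ?thesis
      using * below by (simp add: field_simps)
  qed
  moreover have "norm h \<le> norm (X b) + norm e"
    using norm_triangle_ineq4[of e "X b"] by (simp add: e)
  ultimately show ?thesis
    by simp
qed

text \<open>
  The zero \<open>(u0, v0)\<close> with explicit constants on a ball of radius \<open>s\<close>: \<open>C\<close> bounds the derivative,
  \<open>K\<close> is a Lipschitz constant for it, and \<open>c\<close> measures its injectivity in the second variable. The
  two conditions \<open>small\<close> say that \<open>s\<close> is so small that the error terms in the estimates below take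
  up at most half of what \<open>c\<close> gains.
\<close>

locale regular_zero =
  fixes g :: "'a::real_normed_vector \<times> 'b::real_normed_vector \<Rightarrow> 'c::real_inner"
    and D :: "'a \<times> 'b \<Rightarrow> 'a \<times> 'b \<Rightarrow> 'c"
    and u0 :: 'a and v0 :: 'b and s C K c :: real
  assumes deriv: "\<And>z. z \<in> ball (u0, v0) s \<Longrightarrow> (g has_derivative D z) (at z)"
    and bounded: "\<And>z x. z \<in> ball (u0, v0) s \<Longrightarrow> norm (D z x) \<le> C * norm x"
    and lipschitz: "\<And>z z' x. z \<in> ball (u0, v0) s \<Longrightarrow> z' \<in> ball (u0, v0) s \<Longrightarrow>
           norm (D z x - D z' x) \<le> K * norm (z - z') * norm x"
    and below: "\<And>z k. z \<in> ball (u0, v0) s \<Longrightarrow> c * norm k \<le> norm (D z (0, k))"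
    and zero: "g (u0, v0) = 0"
    and s: "0 < s" and C: "0 \<le> C" and K: "0 \<le> K" and c: "0 < c"
    and small: "K * s \<le> c / 2" "6 * C * K * s \<le> c\<^sup>2"
    and compact: "\<And>\<rho>. compact (cball v0 \<rho>)"
begin

definition critical :: "'a \<Rightarrow> 'b \<Rightarrow> bool" where
  "critical u v \<longleftrightarrow> (\<forall>k. inner (g (u, v)) (D (u, v) (0, k)) = 0)"

text \<open>
  The constant produced by solving \<open>c\<^sup>2 * h \<le> C\<^sup>2 * \<delta> + (c\<^sup>2 / 2) * (\<delta> + h)\<close> for \<open>h\<close>, which is what
  the estimates for two critical points amount to.
\<close>

definition L :: real where "L = 2 * C\<^sup>2 / c\<^sup>2 + 1"

lemma L_nonneg: "0 \<le> L"
  by (simp add: L_def)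

lemma segment_in_ball:
  assumes "z \<in> ball (u0, v0) s" "z' \<in> ball (u0, v0) s" "t \<in> {0..1}"
  shows "z + t *\<^sub>R (z' - z) \<in> ball (u0, v0) s"
proof -
  have "(1 - t) *\<^sub>R z + t *\<^sub>R z' \<in> ball (u0, v0) s"
    using assms convex_ball[of "(u0, v0)" s] by (auto simp: convex_alt)
  then show ?thesis
    by (simp add: algebra_simps)
qed

lemma taylor:
  assumes z: "z \<in> ball (u0, v0) s" "z' \<in> ball (u0, v0) s"
  shows "norm (g z' - g z - D z (z' - z)) \<le> K * (norm (z' - z))\<^sup>2"
proof -
  let ?T = "{x \<in> ball (u0, v0) s. norm (x - z) \<le> norm (z' - z)}"
  have "norm (g z' - g z - D z (z' - z)) \<le> norm (z' - z) * (K * norm (z' - z))"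
  proof (rule differentiable_bound_linearization[where S = ?T and f' = D])
    show "z + t *\<^sub>R (z' - z) \<in> ?T" if "t \<in> {0..1}" for t
      using segment_in_ball[OF z that] that by (simp add: mult_left_le_one_le)
    show "(g has_derivative D x) (at x within ?T)" if "x \<in> ?T" for x
      by (rule has_derivative_at_withinI[OF deriv]) (use that in simp)
    show "onorm (D x - D z) \<le> K * norm (z' - z)" if "x \<in> ?T" for x
    proof (rule onorm_bound)
      show "norm ((D x - D z) y) \<le> K * norm (z' - z) * norm y" for y
        using lipschitz[of x z y] that z(1) K
        by (simp add: order_trans mult_left_mono mult_right_mono)
    qed (simp add: K)
  qed (use z in simp)
  then show ?thesis
    by (simp add: power2_eq_square algebra_simps)
qed

lemma g_lipschitz:
  assumes "z \<in> ball (u0, v0) s" "z' \<in> ball (u0, v0) s"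
  shows "norm (g z - g z') \<le> C * norm (z - z')"
proof (rule differentiable_bound[where f' = D, OF convex_ball[of "(u0, v0)" s] _ _ assms])
  show "(g has_derivative D x) (at x within ball (u0, v0) s)" if "x \<in> ball (u0, v0) s" for x
    by (rule has_derivative_at_withinI[OF deriv[OF that]])
  show "onorm (D x) \<le> C" if "x \<in> ball (u0, v0) s" for x
    by (rule onorm_bound[OF C bounded[OF that]])
qed

lemma center: "(u0, v0) \<in> ball (u0, v0) s"
  using s by simp

lemma g_bound:
  assumes "z \<in> ball (u0, v0) s"
  shows "norm (g z) \<le> C * norm (z - (u0, v0))"
  using g_lipschitz[OF assms center] by (simp add: zero)

lemma D_add:
  assumes "z \<in> ball (u0, v0) s"
  shows "D z (x + y) = D z x + D z y"
  using linear_add[OF has_derivative_linear[OF deriv[OF assms]]] .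

lemma D_split:
  assumes "z \<in> ball (u0, v0) s"
  shows "D z (x, y) = D z (x, 0) + D z (0, y)"
  using D_add[OF assms, of "(x, 0)" "(0, y)"] by simp

text \<open>
  With \<open>h = v1 - v2\<close> and \<open>a = D (u1, v1) (0, h)\<close>, the relation
  \<open>inner (g z1) a = 0 = inner (g z2) (D z2 (0, h))\<close> and the expansion of \<open>g\<close> at \<open>z1\<close> express
  \<open>inner a a\<close> through the shift in \<open>u\<close>, the Taylor error, and the residual at \<open>z2\<close> paired with the
  change of the derivative. The last two are at most \<open>c\<^sup>2 / 2 * norm (z1 - z2) * norm h\<close> in total,
  so half of the lower bound \<open>c\<^sup>2 * (norm h)\<^sup>2\<close> survives.
\<close>

lemma critical_lipschitz:
  assumes z: "(u1, v1) \<in> ball (u0, v0) s" "(u2, v2) \<in> ball (u0, v0) s"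
    and critical: "critical u1 v1" "critical u2 v2"
  shows "norm (v1 - v2) \<le> L * norm (u1 - u2)"
proof (cases "v1 = v2")
  case True
  then show ?thesis
    by (simp add: L_nonneg)
next
  case False
  define z1 z2 h \<delta> where "z1 = (u1, v1)" and "z2 = (u2, v2)" and "h = v1 - v2" and "\<delta> = u1 - u2"
  note z' = z[folded z1_def z2_def]
  let ?a = "D z1 (0, h)" and ?d = "norm (z1 - z2)"
  have diff: "z1 - z2 = (\<delta>, h)"
    by (simp add: z1_def z2_def h_def \<delta>_def)
  have d: "?d \<le> norm \<delta> + norm h" "?d \<le> 2 * s"
  proof -
    show "?d \<le> norm \<delta> + norm h"
      unfolding diff by (rule norm_Pair_le)
    show "?d \<le> 2 * s"
      using z' dist_triangle[of z1 z2 "(u0, v0)"] by (simp add: dist_norm[symmetric] dist_commute)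
  qed
  have a: "norm ?a \<le> C * norm h"
    using bounded[OF z'(1), of "(0, h)"] by simp
  define e where "e = g z1 - g z2 - D z1 (z1 - z2)"
  have "norm e \<le> K * ?d\<^sup>2"
  proof -
    have "e = - (g z2 - g z1 - D z1 (z2 - z1))"
      using linear_diff[OF has_derivative_linear[OF deriv[OF z'(1)]], of z1 z2]
        linear_diff[OF has_derivative_linear[OF deriv[OF z'(1)]], of z2 z1]
      by (simp add: e_def)
    then show ?thesis
      using taylor[OF z'] by (simp add: norm_minus_commute)
  qed
  also have "K * ?d\<^sup>2 \<le> K * (2 * s * ?d)"
    using K d(2) by (intro mult_left_mono) (simp_all add: power2_eq_square mult_right_mono)
  finally have e: "norm e \<le> 2 * K * s * ?d"
    by simp
  have g2: "norm (g z2) \<le> C * s"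
    using g_bound[OF z'(2)] z'(2) C
    by (smt (verit) dist_norm dist_commute mem_ball mult_left_mono)
  have "inner (g z1) ?a = 0" "inner (g z2) (D z2 (0, h)) = 0"
    using critical by (simp_all add: critical_def z1_def z2_def)
  moreover have "g z1 = g z2 + e + D z1 (\<delta>, 0) + ?a"
    using D_split[OF z'(1), of \<delta> h] by (simp add: e_def diff)
  ultimately have "inner ?a ?a =
      - inner (D z1 (\<delta>, 0)) ?a - inner e ?a - inner (g z2) (?a - D z2 (0, h))"
    by (simp add: inner_add_left inner_diff_right)
  also have "\<dots> \<le> norm (D z1 (\<delta>, 0)) * norm ?a + norm e * norm ?a + norm (g z2) * norm (?a - D z2 (0, h))"
    using Cauchy_Schwarz_ineq2[of "D z1 (\<delta>, 0)" ?a] Cauchy_Schwarz_ineq2[of e ?a]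
      Cauchy_Schwarz_ineq2[of "g z2" "?a - D z2 (0, h)"] by linarith
  also have "\<dots> \<le> (C * norm \<delta>) * (C * norm h) + (2 * K * s * ?d) * (C * norm h)
      + (C * s) * (K * ?d * norm h)"
    using bounded[OF z'(1), of "(\<delta>, 0)"] lipschitz[OF z', of "(0, h)"] C K s
    by (intro add_mono mult_mono a e g2) auto
  also have "\<dots> = (C\<^sup>2 * norm \<delta> + (3 * C * K * s) * ?d) * norm h"
    by (simp add: power2_eq_square algebra_simps)
  also have "\<dots> \<le> (C\<^sup>2 * norm \<delta> + (c\<^sup>2 / 2) * (norm \<delta> + norm h)) * norm h"
    using small(2) d(1) by (intro mult_right_mono add_left_mono mult_mono) auto
  finally have upper: "inner ?a ?a \<le> (C\<^sup>2 * norm \<delta> + (c\<^sup>2 / 2) * (norm \<delta> + norm h)) * norm h" .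
  have "(c * norm h)\<^sup>2 \<le> (norm ?a)\<^sup>2"
    using below[OF z'(1), of h] c by (intro power_mono) auto
  also have "\<dots> = inner ?a ?a"
    by (simp add: dot_square_norm)
  also note upper
  finally have "(c\<^sup>2 * norm h) * norm h \<le> (C\<^sup>2 * norm \<delta> + (c\<^sup>2 / 2) * (norm \<delta> + norm h)) * norm h"
    by (simp add: power2_eq_square algebra_simps)
  then have "c\<^sup>2 * norm h \<le> C\<^sup>2 * norm \<delta> + (c\<^sup>2 / 2) * (norm \<delta> + norm h)"
    using False by (auto simp: h_def dest: mult_right_le_imp_le)
  then have "c\<^sup>2 * norm h \<le> (2 * C\<^sup>2 + c\<^sup>2) * norm \<delta>"
    by (simp add: field_simps)
  then show ?thesis
    using c by (simp add: L_def h_def \<delta>_def field_simps)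
qed

text \<open>
  \<open>r\<close> is the radius of the neighborhood of \<open>v0\<close> and \<open>r1\<close> that of the neighborhood of \<open>u0\<close>. The
  second bound on \<open>r1\<close> is what keeps minimizers away from the boundary of \<open>cball v0 r\<close>.
\<close>

definition r :: real where "r = s / 2"

definition r1 :: real where "r1 = min r (c * r / (4 * (C + 1)))"

lemma r_pos: "0 < r" and r1_pos: "0 < r1"
  using s c C by (simp_all add: r_def r1_def)

lemma product_in_ball:
  assumes "u \<in> ball u0 r1" "v \<in> cball v0 r"
  shows "(u, v) \<in> ball (u0, v0) s"
proof -
  have "norm ((u, v) - (u0, v0)) \<le> norm (u - u0) + norm (v - v0)"
    by (simp add: norm_Pair_le)
  also have "\<dots> < r + r"
    using assms by (intro add_less_le_mono) (auto simp: r1_def dist_norm norm_minus_commute)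
  finally show ?thesis
    unfolding mem_ball dist_norm by (subst norm_minus_commute) (simp add: r_def)
qed

text \<open>
  Taylor expansion at \<open>(u, v0)\<close> shows that \<open>norm (g (u, v) - g (u, v0))\<close> is at least
  \<open>c / 2 * norm (v - v0)\<close>. A minimizer \<open>v\<close> satisfies \<open>norm (g (u, v)) \<le> norm (g (u, v0))\<close>, and the
  right-hand side is at most \<open>C * norm (u - u0)\<close>. Hence \<open>norm (v - v0)\<close> is at most
  \<open>4 * C / c * norm (u - u0)\<close>, which is less than \<open>r\<close>.
\<close>

lemma residual_minimum_exists:
  assumes u: "u \<in> ball u0 r1"
  shows "\<exists>v\<in>ball v0 r. \<forall>y\<in>cball v0 r. norm (g (u, v)) \<le> norm (g (u, y))"
proof -
  have "continuous_on (cball v0 r) (\<lambda>v. norm (g (u, v)))"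
  proof (rule continuous_on_norm, rule continuous_on_compose2[of "ball (u0, v0) s" g])
    show "continuous_on (ball (u0, v0) s) g"
      by (meson deriv has_derivative_continuous continuous_at_imp_continuous_on)
    show "continuous_on (cball v0 r) (Pair u)"
      by (intro continuous_intros)
  qed (use product_in_ball[OF u] in auto)
  then obtain v where v: "v \<in> cball v0 r" "\<forall>y\<in>cball v0 r. norm (g (u, v)) \<le> norm (g (u, y))"
    using continuous_attains_inf[OF compact, of r] r_pos by force
  define h where "h = v - v0"
  have z: "(u, v) \<in> ball (u0, v0) s" "(u, v0) \<in> ball (u0, v0) s"
    using product_in_ball[OF u] v(1) r_pos by auto
  have "norm h \<le> s"
    using v(1) r_pos by (simp add: h_def r_def dist_norm norm_minus_commute)
  have "norm (g (u, v) - g (u, v0) - D (u, v0) (0, h)) \<le> K * (norm h)\<^sup>2"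
    using taylor[OF z(2,1)] by (simp add: h_def)
  also have "\<dots> \<le> K * (s * norm h)"
    using \<open>norm h \<le> s\<close> K by (intro mult_left_mono) (simp_all add: power2_eq_square mult_right_mono)
  also have "\<dots> \<le> c / 2 * norm h"
    using mult_right_mono[OF small(1), of "norm h"] by simp
  finally have "norm (D (u, v0) (0, h)) \<le> c / 2 * norm h + norm (g (u, v)) + norm (g (u, v0))"
    using norm_triangle_ineq4[of "g (u, v) - g (u, v0)" "g (u, v) - g (u, v0) - D (u, v0) (0, h)"]
      norm_triangle_ineq4[of "g (u, v)" "g (u, v0)"] by simp
  moreover have "norm (g (u, v)) \<le> norm (g (u, v0))"
    using v(2) r_pos by simp
  moreover have "norm (g (u, v0)) \<le> C * norm (u - u0)"
    using g_bound[OF z(2)] by simp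
  moreover have "c * norm h \<le> norm (D (u, v0) (0, h))"
    by (rule below[OF z(2)])
  ultimately have "c * norm h \<le> 4 * C * norm (u - u0)"
    by linarith
  also have "\<dots> \<le> 4 * (C + 1) * norm (u - u0)"
    by (intro mult_right_mono) auto
  also have "\<dots> < 4 * (C + 1) * (c * r / (4 * (C + 1)))"
    using u C by (intro mult_strict_left_mono) (auto simp: r1_def dist_norm norm_minus_commute)
  also have "\<dots> = c * r"
    using C by simp
  finally have "norm h < r"
    using c by simp
  then have "v \<in> ball v0 r"
    by (simp add: h_def dist_norm norm_minus_commute)
  with v(2) show ?thesis
    by blast
qed

lemma critical_zero: "critical u0 v0"
  by (simp add: critical_def zero)

text \<open>
  Replacing \<open>g (u, v)\<close> by its linearization at the zero, and \<open>D (u, v)\<close> by the derivative there,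
  costs two errors, each quadratic in the distance to the zero: the Taylor error, and the residual
  times the change of the derivative. By \<open>critical_lipschitz\<close> the distance is at most
  \<open>(1 + L) * norm (u - u0)\<close>.
\<close>

lemma critical_normal_equation:
  assumes z: "(u, v) \<in> ball (u0, v0) s" and critical: "critical u v"
  shows "inner (D (u0, v0) (u - u0, v - v0)) (D (u0, v0) (0, k))
      \<le> 2 * C * K * (1 + L)\<^sup>2 * (norm (u - u0))\<^sup>2 * norm k"
proof -
  define \<delta> h where "\<delta> = u - u0" and "h = v - v0"
  let ?D = "D (u0, v0)" and ?d = "norm (\<delta>, h)"
  have h: "norm h \<le> L * norm \<delta>"
    unfolding h_def \<delta>_def by (rule critical_lipschitz[OF z center critical critical_zero])
  have "?d \<le> norm \<delta> + norm h"
    by (rule norm_Pair_le)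
  also have "\<dots> \<le> (1 + L) * norm \<delta>"
    using h by (simp add: algebra_simps)
  finally have d: "?d \<le> (1 + L) * norm \<delta>" .
  define e where "e = g (u, v) - ?D (\<delta>, h)"
  have e: "norm e \<le> K * ?d\<^sup>2"
    using taylor[OF center z] by (simp add: e_def zero \<delta>_def h_def)
  have "inner (?D (\<delta>, h)) (?D (0, k)) =
      inner (g (u, v)) (?D (0, k) - D (u, v) (0, k)) - inner e (?D (0, k))"
    using critical by (simp add: e_def critical_def inner_diff_left inner_diff_right)
  also have "\<dots> \<le> norm (g (u, v)) * norm (?D (0, k) - D (u, v) (0, k)) + norm e * norm (?D (0, k))"
    using Cauchy_Schwarz_ineq2[of "g (u, v)" "?D (0, k) - D (u, v) (0, k)"]
      Cauchy_Schwarz_ineq2[of e "?D (0, k)"] by linarith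
  also have "\<dots> \<le> (C * ?d) * (K * ?d * norm k) + (K * ?d\<^sup>2) * (C * norm k)"
    using g_bound[OF z] lipschitz[OF center z, of "(0, k)"] bounded[OF center, of "(0, k)"] e C K
    by (intro add_mono mult_mono) (auto simp: \<delta>_def h_def norm_Pair norm_minus_commute)
  also have "\<dots> = 2 * C * K * norm k * ?d\<^sup>2"
    by (simp add: power2_eq_square algebra_simps)
  also have "\<dots> \<le> 2 * C * K * norm k * ((1 + L) * norm \<delta>)\<^sup>2"
    using d C K by (intro mult_left_mono power_mono) auto
  finally show ?thesis
    by (simp add: power_mult_distrib \<delta>_def h_def ac_simps)
qed

lemma least_squares_solution_imp_critical:
  assumes "(u, v) \<in> ball (u0, v0) s"
    and "least_squares_solution \<Theta> (\<lambda>v. g (u, v)) v"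
  shows "critical u v"
proof -
  have "((\<lambda>v. g (u, v)) has_derivative (\<lambda>k. D (u, v) (0, k))) (at v)"
    by (rule has_derivative_compose[where f = "Pair u", OF _ deriv[OF assms(1)]])
      (auto intro!: derivative_eq_intros)
  then show ?thesis
    unfolding critical_def using least_squares_solution_critical[OF assms(2)] by blast
qed

lemma least_squares_solution_exists:
  assumes u: "u \<in> ball u0 r1" and S: "ball (u0, v0) s \<subseteq> S"
  shows "\<exists>v\<in>ball v0 r. least_squares_solution {v. (u, v) \<in> S} (\<lambda>v. g (u, v)) v"
proof -
  obtain v where v: "v \<in> ball v0 r" "\<forall>y\<in>cball v0 r. norm (g (u, v)) \<le> norm (g (u, y))"
    using residual_minimum_exists[OF u] by blast
  have sub: "ball v0 r \<subseteq> {v. (u, v) \<in> S}"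
    using S product_in_ball[OF u] by (auto simp: subset_eq)
  have "least_squares_solution {v. (u, v) \<in> S} (\<lambda>v. g (u, v)) v"
    unfolding least_squares_solution_def
  proof (intro conjI exI[of _ "ball v0 r"])
    show "v \<in> {v. (u, v) \<in> S}"
      using v(1) sub by blast
    show "\<forall>y\<in>ball v0 r. (norm (g (u, v)))\<^sup>2 \<le> (norm (g (u, y)))\<^sup>2"
      using v(2) by (auto intro!: power_mono)
  qed (use v sub in auto)
  with v(1) show ?thesis
    by blast
qed

end

section \<open>The least squares solution as a function of the data\<close>

lemma partial_jacobians:
  assumes "(f has_derivative E) (at (u0, v0))"
  shows "jacobian_u f u0 v0 = (\<lambda>x. E (x, 0))" and "jacobian_v f u0 v0 = (\<lambda>y. E (0, y))"
    and "bounded_linear (jacobian_u f u0 v0)"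
proof -
  have u: "((\<lambda>u. f (u, v0)) has_derivative (\<lambda>x. E (x, 0))) (at u0)"
    by (rule has_derivative_compose[where f = "\<lambda>u. (u, v0)", OF _ assms])
      (auto intro!: derivative_eq_intros)
  have v: "((\<lambda>v. f (u0, v)) has_derivative (\<lambda>y. E (0, y))) (at v0)"
    by (rule has_derivative_compose[where f = "Pair u0", OF _ assms])
      (auto intro!: derivative_eq_intros)
  show eq: "jacobian_u f u0 v0 = (\<lambda>x. E (x, 0))"
    unfolding jacobian_u_def by (rule frechet_derivative_at[OF u, symmetric])
  show "jacobian_v f u0 v0 = (\<lambda>y. E (0, y))"
    unfolding jacobian_v_def by (rule frechet_derivative_at[OF v, symmetric])
  show "bounded_linear (jacobian_u f u0 v0)"
    unfolding eq by (rule has_derivative_bounded_linear[OF u])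
qed

lemma quadratic_smallo_norm:
  fixes u0 :: "'a::real_normed_vector" and Q :: real
  assumes "0 \<le> Q"
  shows "(\<lambda>u. Q * (norm (u - u0))\<^sup>2) \<in> o[nhds u0](\<lambda>u. norm (u - u0))"
proof (rule landau_o.smallI)
  fix \<epsilon> :: real assume "0 < \<epsilon>"
  have "Q * norm (u - u0) \<le> \<epsilon>" if "dist u u0 < \<epsilon> / (Q + 1)" for u
  proof -
    have "Q * norm (u - u0) \<le> (Q + 1) * norm (u - u0)"
      by (intro mult_right_mono) auto
    also have "\<dots> \<le> \<epsilon>"
      using that assms by (simp add: dist_norm field_simps)
    finally show ?thesis .
  qed
  then have "norm (Q * (norm (u - u0))\<^sup>2) \<le> \<epsilon> * norm (norm (u - u0))"
    if "dist u u0 < \<epsilon> / (Q + 1)" for u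
    using mult_right_mono[of "Q * norm (u - u0)" \<epsilon> "norm (u - u0)"] that assms
    by (simp add: power2_eq_square mult.assoc abs_mult)
  then show "\<forall>\<^sub>F u in nhds u0. norm (Q * (norm (u - u0))\<^sup>2) \<le> \<epsilon> * norm (norm (u - u0))"
    unfolding eventually_nhds_metric using \<open>0 < \<epsilon>\<close> assms
    by (intro exI[of _ "\<epsilon> / (Q + 1)"]) simp
qed

theorem lemma2:
  fixes M :: "'u::complex_normed_vector set"
    and hU :: "'u \<Rightarrow> complex ^ 'l"
    and hV :: "'v::complex_normed_vector \<Rightarrow> complex ^ 'm"
    and hW :: "'w::complex_normed_vector \<Rightarrow> complex ^ 'n"
    and d :: nat
  assumes "isometric_isomorphism hU"
    and "isometric_isomorphism hV"
    and "isometric_isomorphism hW"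
    and "CARD('m) \<le> CARD('n)"
    and "CARD('n) \<le> CARD('l) + CARD('m)"
    and "complex_analytic_manifold TYPE('x::complex_normed_vector) d M"
    and "\<forall>u0\<in>M. \<exists>Om (f :: 'u \<times> 'v \<Rightarrow> 'w) v0. defining_system M Om f u0 v0"
  shows "\<forall>u0\<in>M. \<forall>Om (f :: 'u \<times> 'v \<Rightarrow> 'w) v0. defining_system M Om f u0 v0 \<longrightarrow>
    (\<exists>\<Psi> \<Phi> \<pi>.
       open \<Psi> \<and> u0 \<in> \<Psi> \<and> open \<Phi> \<and> v0 \<in> \<Phi> \<and>
       (\<forall>u\<in>\<Psi>. \<pi> u \<in> \<Phi> \<and>
          least_squares_solution {v. (u, v) \<in> Om} (\<lambda>v. f (u, v)) (\<pi> u) \<and>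
          (\<forall>v\<in>\<Phi>. least_squares_solution {v. (u, v) \<in> Om} (\<lambda>v. f (u, v)) v \<longrightarrow> v = \<pi> u)) \<and>
       (\<forall>\<Phi>'. open \<Phi>' \<and> v0 \<in> \<Phi>' \<and> \<Phi>' \<subseteq> \<Phi> \<longrightarrow>
          (\<exists>\<Psi>'. open \<Psi>' \<and> u0 \<in> \<Psi>' \<and> \<Psi>' \<subseteq> \<Psi> \<and> \<pi> ` \<Psi>' \<subseteq> \<Phi>')) \<and>
       (\<forall>u\<in>\<Psi>. \<exists>\<Sigma> L. open \<Sigma> \<and> u \<in> \<Sigma> \<and> \<Sigma> \<subseteq> \<Psi> \<and> L-lipschitz_on \<Sigma> \<pi>) \<and>
       (\<exists>\<rho> :: 'u \<Rightarrow> real. \<rho> \<in> o[nhds u0](\<lambda>u. norm (u - u0)) \<and>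
          (\<forall>u\<in>\<Psi>. norm (\<pi> u - v0) \<le>
             onorm (moore_penrose hV hW (jacobian_v f u0 v0)) * onorm (jacobian_u f u0 v0) *
               norm (u - u0) + \<rho> u)))"
proof (intro ballI allI impI)
  fix u0 Om and f :: "'u \<times> 'v \<Rightarrow> 'w" and v0
  assume "defining_system M Om f u0 v0"
  then have Om: "open Om" "(u0, v0) \<in> Om" and holo: "holomorphic_map_on f Om"
    and f0: "f (u0, v0) = 0" and inj: "inj (jacobian_v f u0 v0)"
    by (simp_all add: defining_system_def)
  note hV = \<open>isometric_isomorphism hV\<close> and hW = \<open>isometric_isomorphism hW\<close>
  interpret hW: bounded_linear hW
    by (rule isometric_isomorphism_bounded_linear[OF hW])
  define E where "E z = frechet_derivative f (at z)" for z
  define g where "g z = hW (f z)" for z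
  define D where "D z x = hW (E z x)" for z x
  have f': "(f has_derivative E z) (at z)" and clin: "clinear (E z)" if z: "z \<in> Om" for z
  proof -
    obtain F where F: "clinear F" "(f has_derivative F) (at z)"
      using holo z unfolding holomorphic_map_on_open_iff[OF Om(1)] complex_differentiable_def
      by blast
    have "F = E z"
      unfolding E_def by (rule frechet_derivative_at[OF F(2)])
    with F show "(f has_derivative E z) (at z)" and "clinear (E z)"
      by simp_all
  qed
  have g': "(g has_derivative D z) (at z)" if "z \<in> Om" for z
    unfolding g_def[abs_def] D_def[abs_def] by (rule hW.has_derivative[OF f'[OF that]])
  have hom: "D z (a *\<^sub>C x) = a *s D z x" if "z \<in> Om" for z a x
  proof -
    interpret Vector_Spaces.linear scaleC scaleC "E z"
      by (rule clin[OF that])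
    show ?thesis
      by (simp add: D_def scale isometric_isomorphismD(2)[OF hW])
  qed
  obtain \<delta> C K where \<delta>: "0 < \<delta>" "ball (u0, v0) \<delta> \<subseteq> Om" and "0 \<le> C" "0 \<le> K"
    and C: "\<And>z x. z \<in> ball (u0, v0) \<delta> \<Longrightarrow> norm (D z x) \<le> C * norm x"
    and K: "\<And>z z' x. z \<in> ball (u0, v0) \<delta> \<Longrightarrow> z' \<in> ball (u0, v0) \<delta> \<Longrightarrow>
           norm (D z x - D z' x) \<le> K * norm (z - z') * norm x"
    using holomorphic_derivative_locally_lipschitz[OF Om g' hom] by metis
  define A where "A = jacobian_v f u0 v0"
  define B where "B = jacobian_u f u0 v0"
  note jac = partial_jacobians[OF f'[OF Om(2)], folded A_def B_def]
  have D0: "D (u0, v0) (0, k) = hW (A k)" "D (u0, v0) (x, k) = hW (B x) + hW (A k)" for x k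
  proof -
    have "E (u0, v0) (x, k) = E (u0, v0) (x, 0) + E (u0, v0) (0, k)"
      using linear_add[OF has_derivative_linear[OF f'[OF Om(2)]], of "(x, 0)" "(0, k)"] by simp
    then show "D (u0, v0) (0, k) = hW (A k)" "D (u0, v0) (x, k) = hW (B x) + hW (A k)"
      by (simp_all add: D_def jac hW.add)
  qed
  have A: "clinear A"
  proof -
    interpret E: Vector_Spaces.linear scaleC scaleC "E (u0, v0)"
      by (rule clin[OF Om(2)])
    show ?thesis
    proof unfold_locales
      show "A (x + y) = A x + A y" for x y
        using E.add[of "(0, x)" "(0, y)"] by (simp add: jac)
      show "A (a *\<^sub>C x) = a *\<^sub>C A x" for a x
        using E.scale[of a "(0, x)"] by (simp add: jac scaleC_prod_def)
    qed
  qed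
  interpret A: Vector_Spaces.linear scaleC scaleC A
    by (rule A)
  have "linear (\<lambda>k. hW (A k))"
    by (intro linearI) (simp_all add: A.add hW.add scaleR_scaleC A.scale flip: hW.scaleR)
  moreover have "inj (\<lambda>k. hW (A k))"
    using inj isometric_isomorphism_inv(1)[OF hW] by (metis A_def injD injI)
  ultimately obtain c0 where c0: "0 < c0" "\<And>k. c0 * norm k \<le> norm (hW (A k))"
    using linear_inj_bounded_below_pos by blast
  \<comment> \<open>half of the bound at the center survives on a small ball, by continuity of the derivative\<close>
  define c where "c = c0 / 2"
  have c: "0 < c"
    using c0 by (simp add: c_def)
  \<comment> \<open>the \<open>+ 1\<close> keep the denominators positive when \<open>K\<close> or \<open>C\<close> vanishes\<close>
  define s where "s = min \<delta> (min (c / (2 * (K + 1))) (c\<^sup>2 / (6 * (C * K + 1))))"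
  have s: "0 < s" "s \<le> \<delta>"
    using \<delta>(1) c \<open>0 \<le> C\<close> \<open>0 \<le> K\<close> by (auto simp: s_def intro!: divide_pos_pos add_nonneg_pos)
  have Ks: "K * s \<le> c / 2"
  proof -
    have "K * s \<le> (K + 1) * (c / (2 * (K + 1)))"
      using s(1) \<open>0 \<le> K\<close> by (intro mult_mono) (auto simp: s_def)
    also have "\<dots> = c / 2"
      using \<open>0 \<le> K\<close> by (simp add: divide_simps)
    finally show ?thesis .
  qed
  have CKs: "6 * C * K * s \<le> c\<^sup>2"
  proof -
    have "6 * (C * K) * s \<le> 6 * (C * K + 1) * (c\<^sup>2 / (6 * (C * K + 1)))"
      using s(1) \<open>0 \<le> C\<close> \<open>0 \<le> K\<close> by (intro mult_mono) (auto simp: s_def)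
    moreover have "0 < C * K + 1"
      using \<open>0 \<le> C\<close> \<open>0 \<le> K\<close> by (intro add_nonneg_pos) auto
    ultimately show ?thesis
      by (simp add: mult.assoc)
  qed
  have ball_s: "z \<in> ball (u0, v0) \<delta>" "z \<in> Om" if "z \<in> ball (u0, v0) s" for z
    using that s \<delta>(2) by (auto simp: subset_eq)
  interpret regular_zero g D u0 v0 s C K c
  proof
    show "c * norm k \<le> norm (D z (0, k))" if z: "z \<in> ball (u0, v0) s" for z k
    proof -
      have center: "(u0, v0) \<in> ball (u0, v0) \<delta>"
        using \<delta>(1) by simp
      have "norm (D z (0, k) - D (u0, v0) (0, k)) \<le> K * norm (z - (u0, v0)) * norm k"
        using K[OF ball_s(1)[OF z] center, of "(0, k)"] by simp
      also have "\<dots> \<le> K * s * norm k"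
        using z \<open>0 \<le> K\<close> by (intro mult_right_mono mult_left_mono) (auto simp: dist_norm norm_minus_commute)
      also have "\<dots> \<le> c * norm k"
        using Ks c by (intro mult_right_mono) auto
      finally have "norm (D (u0, v0) (0, k)) \<le> norm (D z (0, k)) + c * norm k"
        using norm_triangle_ineq3[of "D z (0, k)" "D (u0, v0) (0, k)"] by linarith
      then show ?thesis
        using c0(2)[of k] by (simp add: D0(1) c_def)
    qed
    show "g (u0, v0) = 0"
      by (simp add: g_def f0 hW.zero)
  qed (fact g'[OF ball_s(2)] C[OF ball_s(1)] K[OF ball_s(1) ball_s(1)] s c Ks CKs \<open>0 \<le> C\<close> \<open>0 \<le> K\<close>
      isometric_isomorphism_compact_cball[OF hV])+
  let ?lsq = "\<lambda>u. least_squares_solution {v. (u, v) \<in> Om} (\<lambda>v. f (u, v))"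
  have lsq_g: "?lsq u v \<longleftrightarrow> least_squares_solution {v. (u, v) \<in> Om} (\<lambda>v. g (u, v)) v" for u v
    by (simp add: least_squares_solution_def g_def isometric_isomorphismD(3)[OF hW])
  have "\<exists>v\<in>ball v0 r. ?lsq u v" if "u \<in> ball u0 r1" for u
    unfolding lsq_g using ball_s by (intro least_squares_solution_exists that) auto
  then obtain \<pi> where \<pi>: "\<And>u. u \<in> ball u0 r1 \<Longrightarrow> \<pi> u \<in> ball v0 r \<and> ?lsq u (\<pi> u)"
    by metis
  have in_ball: "(u, v) \<in> ball (u0, v0) s" if "u \<in> ball u0 r1" "v \<in> ball v0 r" for u v
    using that by (intro product_in_ball) auto
  have crit: "critical u v" if "u \<in> ball u0 r1" "v \<in> ball v0 r" "?lsq u v" for u v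
    using that by (intro least_squares_solution_imp_critical in_ball) (auto simp: lsq_g)
  have unique: "v = \<pi> u" if "u \<in> ball u0 r1" "v \<in> ball v0 r" "?lsq u v" for u v
    using critical_lipschitz[of u v u "\<pi> u"] crit[OF that] crit[of u "\<pi> u"] \<pi>[OF that(1)] in_ball that
    by simp
  have lip: "L-lipschitz_on (ball u0 r1) \<pi>"
  proof (rule lipschitz_onI[OF _ L_nonneg])
    show "dist (\<pi> x) (\<pi> y) \<le> L * dist x y" if "x \<in> ball u0 r1" "y \<in> ball u0 r1" for x y
      unfolding dist_norm using that \<pi> by (intro critical_lipschitz in_ball crit) auto
  qed
  have u0: "u0 \<in> ball u0 r1"
    using r1_pos by simp
  have \<pi>0: "\<pi> u0 = v0"
    using critical_lipschitz[of u0 "\<pi> u0" u0 v0] crit[of u0 "\<pi> u0"] \<pi>[OF u0] in_ball u0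
      critical_zero center by simp
  define X where "X = moore_penrose hV hW A"
  note X = moore_penrose_injective[OF hV hW A inj[folded A_def], folded X_def]
  define Q where "Q = 2 * C * K * (1 + L)\<^sup>2 / c\<^sup>2"
  have "0 \<le> Q"
    using \<open>0 \<le> C\<close> \<open>0 \<le> K\<close> by (simp add: Q_def)
  have error: "norm (\<pi> u - v0) \<le> onorm X * onorm B * norm (u - u0) + Q * (norm (u - u0))\<^sup>2"
    if u: "u \<in> ball u0 r1" for u
  proof -
    \<comment> \<open>the Moore-Penrose inverse on the coordinates of \<open>'w\<close>, where the inner product lives\<close>
    let ?Y = "\<lambda>y. X (inv hW y)"
    have "norm (\<pi> u - v0) \<le> norm (?Y (hW (B (u - u0))))
        + (2 * C * K * (1 + L)\<^sup>2 * (norm (u - u0))\<^sup>2) / c\<^sup>2"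
    proof (rule least_squares_residual_bound[where A = "\<lambda>k. hW (A k)" and X = ?Y])
      show "linear ?Y"
        by (intro bounded_linear.linear bounded_linear_compose[OF X(1)] isometric_isomorphism_inv(4)[OF hW])
      show "?Y (hW (A (\<pi> u - v0))) = \<pi> u - v0"
        by (simp add: isometric_isomorphism_inv[OF hW] X(2))
      show "inner (w - hW (A (?Y w))) (hW (A k)) = 0" for w k
        using X(3)[of "inv hW w" k] by (simp add: isometric_isomorphism_inv[OF hW])
      show "c * norm k \<le> norm (hW (A k))" for k
        using below[OF center, of k] by (simp add: D0(1))
      show "inner (hW (B (u - u0)) + hW (A (\<pi> u - v0))) (hW (A k))
          \<le> 2 * C * K * (1 + L)\<^sup>2 * (norm (u - u0))\<^sup>2 * norm k" for k
        using critical_normal_equation[of u "\<pi> u" k] in_ball crit \<pi>[OF u] u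
          by (simp add: D0(1) D0(2)[of "u - u0"])
    qed (use c \<open>0 \<le> C\<close> \<open>0 \<le> K\<close> in simp_all)
    also have "norm (?Y (hW (B (u - u0)))) \<le> onorm X * norm (B (u - u0))"
      by (simp add: isometric_isomorphism_inv[OF hW] onorm[OF X(1)])
    also have "\<dots> \<le> onorm X * (onorm B * norm (u - u0))"
      by (intro mult_left_mono onorm[OF jac(3)] onorm_pos_le[OF X(1)])
    finally show ?thesis
      by (simp add: Q_def)
  qed
  show "\<exists>\<Psi> \<Phi> \<pi>.
       open \<Psi> \<and> u0 \<in> \<Psi> \<and> open \<Phi> \<and> v0 \<in> \<Phi> \<and>
       (\<forall>u\<in>\<Psi>. \<pi> u \<in> \<Phi> \<and> ?lsq u (\<pi> u) \<and> (\<forall>v\<in>\<Phi>. ?lsq u v \<longrightarrow> v = \<pi> u)) \<and>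
       (\<forall>\<Phi>'. open \<Phi>' \<and> v0 \<in> \<Phi>' \<and> \<Phi>' \<subseteq> \<Phi> \<longrightarrow>
          (\<exists>\<Psi>'. open \<Psi>' \<and> u0 \<in> \<Psi>' \<and> \<Psi>' \<subseteq> \<Psi> \<and> \<pi> ` \<Psi>' \<subseteq> \<Phi>')) \<and>
       (\<forall>u\<in>\<Psi>. \<exists>\<Sigma> L. open \<Sigma> \<and> u \<in> \<Sigma> \<and> \<Sigma> \<subseteq> \<Psi> \<and> L-lipschitz_on \<Sigma> \<pi>) \<and>
       (\<exists>\<rho> :: 'u \<Rightarrow> real. \<rho> \<in> o[nhds u0](\<lambda>u. norm (u - u0)) \<and>
          (\<forall>u\<in>\<Psi>. norm (\<pi> u - v0) \<le>
             onorm (moore_penrose hV hW (jacobian_v f u0 v0)) * onorm (jacobian_u f u0 v0) *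
               norm (u - u0) + \<rho> u))"
  proof (rule exI[of _ "ball u0 r1"], rule exI[of _ "ball v0 r"], rule exI[of _ \<pi>],
      intro conjI ballI allI impI)
    fix \<Phi>' assume \<Phi>': "open \<Phi>' \<and> v0 \<in> \<Phi>' \<and> \<Phi>' \<subseteq> ball v0 r"
    have "open (ball u0 r1 \<inter> \<pi> -` \<Phi>')"
      using lipschitz_on_continuous_on[OF lip] \<Phi>' by (simp add: continuous_on_open_vimage Int_commute)
    then show "\<exists>\<Psi>'. open \<Psi>' \<and> u0 \<in> \<Psi>' \<and> \<Psi>' \<subseteq> ball u0 r1 \<and> \<pi> ` \<Psi>' \<subseteq> \<Phi>'"
      using \<Phi>' u0 \<pi>0 by (intro exI[of _ "ball u0 r1 \<inter> \<pi> -` \<Phi>'"]) auto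
  next
    show "\<exists>\<Sigma> L. open \<Sigma> \<and> u \<in> \<Sigma> \<and> \<Sigma> \<subseteq> ball u0 r1 \<and> L-lipschitz_on \<Sigma> \<pi>" if "u \<in> ball u0 r1" for u
      using that lip by (intro exI[of _ "ball u0 r1"] exI[of _ L]) auto
  next
    show "\<exists>\<rho> :: 'u \<Rightarrow> real. \<rho> \<in> o[nhds u0](\<lambda>u. norm (u - u0)) \<and>
          (\<forall>u\<in>ball u0 r1. norm (\<pi> u - v0) \<le>
             onorm (moore_penrose hV hW (jacobian_v f u0 v0)) * onorm (jacobian_u f u0 v0) *
               norm (u - u0) + \<rho> u)"
      using error quadratic_smallo_norm[OF \<open>0 \<le> Q\<close>, of u0] unfolding X_def A_def B_def by blast
  qed (use \<pi> unique u0 r_pos in auto)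
qed

end
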